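(* Let $X\subset\mathbb{R}^2$ be a real algebraic curve and let $x\in X$ be a geometric singular point, with local branch parametrized, in Euclidean coordinates with $x$ at the origin and the $x_1$-axis along the tangent line, by $$x_1(t)=t^p,\qquad x_2(t)=c\,t^q+\sigma_{q+1}(t),$$ where $q>p\ge 2$, $p$ is even and $c\ne 0$. Then for all points $u=(u_1,u_2)$ outside the normal line $N_x=\{u_1=0\}$ the function $\mathbb{D}_u$ is critical at $x$, and the type of the critical point is: - a (local) maximum if $u_1>0$; - a (local) minimum if $u_1<0$.
   Context: $X$ is a reduced real algebraic curve all of whose local branches are real and $1$-dimensional. $\mathbb{D}_u(y)=|y-u|^2$ for $y\in X$, considered on the normalization of $X$, i.e. as a function of the parameter $t$ on the local branch. $\sigma_{q+1}$ is a real convergent power series with all terms of degree $>q$. A geometric singular (cuspidal) point is a point at which a local branch has $p$ even. $\mathbb{D}_u$ is topologically regular at $x$ if it is, as a function on the normalized branch, locally homeomorphic to a linear function; at a geometric singular point, $\mathbb{D}_u$ is called critical if it is not topologically regular. *)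

theory Defs
  imports
    "HOL-Analysis.Analysis"
    "HOL-Computational_Algebra.Computational_Algebra"
begin

text \<open>Polynomials in two variables are elements of \<open>'a poly poly\<close>: the outer variable is the
  second coordinate, the inner variable the first one.\<close>

definition poly2 :: "'a::comm_ring_1 poly poly \<Rightarrow> 'a \<Rightarrow> 'a \<Rightarrow> 'a" where
  "poly2 f a b = poly (poly f [:b:]) a"

definition complex_poly2 :: "real poly poly \<Rightarrow> complex poly poly" where
  "complex_poly2 f = map_poly (map_poly complex_of_real) f"

definition complex_fps :: "real fps \<Rightarrow> complex fps" where
  "complex_fps A = Abs_fps (\<lambda>n. complex_of_real (fps_nth A n))"

text \<open>Injectivity near 0 of the complex parametrization says that it is the normalization of the
  branch it traces, and not a covering of it of higher degree.\<close>

definition primitive_pair :: "complex fps \<Rightarrow> complex fps \<Rightarrow> bool" where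
  "primitive_pair A B \<longleftrightarrow>
     fps_conv_radius A > 0 \<and> fps_conv_radius B > 0 \<and>
     (\<exists>r>0. inj_on (\<lambda>z. (eval_fps A z, eval_fps B z)) (ball 0 r))"

definition complex_branch :: "real poly poly \<Rightarrow> real^2 \<Rightarrow> complex fps \<Rightarrow> complex fps \<Rightarrow> bool" where
  "complex_branch f x A B \<longleftrightarrow>
     primitive_pair A B \<and>
     fps_nth A 0 = of_real (x $ 1) \<and> fps_nth B 0 = of_real (x $ 2) \<and>
     (\<forall>\<^sub>F z in nhds 0. poly2 (complex_poly2 f) (eval_fps A z) (eval_fps B z) = 0)"

text \<open>A branch is real and 1-dimensional if, after a holomorphic change of the parameter, it is
  parametrized by real power series; otherwise the centre is its only real point.\<close>

definition real_one_dimensional :: "complex fps \<Rightarrow> complex fps \<Rightarrow> bool" where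
  "real_one_dimensional A B \<longleftrightarrow>
     (\<exists>h A' B'. fps_conv_radius h > 0 \<and> fps_nth h 0 = 0 \<and> fps_nth h 1 \<noteq> 0 \<and>
        fps_compose A h = complex_fps A' \<and> fps_compose B h = complex_fps B')"

definition real_algebraic_curve :: "(real^2) set \<Rightarrow> bool" where
  "real_algebraic_curve X \<longleftrightarrow>
     (\<exists>f :: real poly poly. squarefree f \<and> \<not> f dvd 1 \<and>
        X = {v. poly2 f (v $ 1) (v $ 2) = 0} \<and>
        (\<forall>x\<in>X. \<forall>A B. complex_branch f x A B \<longrightarrow> real_one_dimensional A B))"

definition orthonormal_frame :: "real^2 \<Rightarrow> real^2 \<Rightarrow> bool" where
  "orthonormal_frame e1 e2 \<longleftrightarrow> norm e1 = 1 \<and> norm e2 = 1 \<and> e1 \<bullet> e2 = 0"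

text \<open>The series \<open>A\<close> and \<open>B\<close> are the Euclidean coordinates of the curve with respect to the
  origin \<open>x\<close> and the orthonormal frame \<open>e1\<close>, \<open>e2\<close>.\<close>

definition branch_param :: "real^2 \<Rightarrow> real^2 \<Rightarrow> real^2 \<Rightarrow> real fps \<Rightarrow> real fps \<Rightarrow> real \<Rightarrow> real^2" where
  "branch_param x e1 e2 A B t = x + eval_fps A t *\<^sub>R e1 + eval_fps B t *\<^sub>R e2"

definition local_branch ::
  "(real^2) set \<Rightarrow> real^2 \<Rightarrow> real^2 \<Rightarrow> real^2 \<Rightarrow> real fps \<Rightarrow> real fps \<Rightarrow> bool" where
  "local_branch X x e1 e2 A B \<longleftrightarrow>
     orthonormal_frame e1 e2 \<and>
     fps_conv_radius A > 0 \<and> fps_conv_radius B > 0 \<and>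
     fps_nth A 0 = 0 \<and> fps_nth B 0 = 0 \<and>
     primitive_pair (complex_fps A) (complex_fps B) \<and>
     (\<forall>\<^sub>F t in nhds 0. branch_param x e1 e2 A B t \<in> X)"

text \<open>Since \<open>q > p\<close>, the vector \<open>e1\<close> spans the tangent line of the branch at \<open>x\<close>.\<close>

definition branch_normal_form ::
  "real fps \<Rightarrow> real fps \<Rightarrow> nat \<Rightarrow> nat \<Rightarrow> real \<Rightarrow> real fps \<Rightarrow> bool" where
  "branch_normal_form A B p q c \<sigma> \<longleftrightarrow>
     q > p \<and> c \<noteq> 0 \<and>
     fps_conv_radius \<sigma> > 0 \<and> (\<forall>n\<le>q. fps_nth \<sigma> n = 0) \<and>
     A = fps_X ^ p \<and> B = fps_const c * fps_X ^ q + \<sigma>"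

definition geometric_singular_point :: "(real^2) set \<Rightarrow> real^2 \<Rightarrow> bool" where
  "geometric_singular_point X x \<longleftrightarrow>
     (\<exists>e1 e2 A B p q c \<sigma>. local_branch X x e1 e2 A B \<and> branch_normal_form A B p q c \<sigma> \<and>
        p \<ge> 2 \<and> even p)"

definition sq_dist :: "real^2 \<Rightarrow> real^2 \<Rightarrow> real" where
  "sq_dist u y = (norm (y - u))\<^sup>2"

definition normal_line :: "real^2 \<Rightarrow> real^2 \<Rightarrow> (real^2) set" where
  "normal_line x e1 = {u. (u - x) \<bullet> e1 = 0}"

text \<open>A linear function is understood to be nonzero: a locally constant function is not regular.\<close>

definition topologically_regular_at :: "(real \<Rightarrow> real) \<Rightarrow> real \<Rightarrow> bool" where
  "topologically_regular_at g t0 \<longleftrightarrow>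
     (\<exists>U V (\<phi> :: real \<Rightarrow> real) \<psi> l. open U \<and> open V \<and> t0 \<in> U \<and> homeomorphism U V \<phi> \<psi> \<and>
        linear l \<and> l \<noteq> (\<lambda>s. 0) \<and> (\<forall>t\<in>U. g t = (l (\<phi> t) :: real)))"

definition critical_at :: "(real \<Rightarrow> real) \<Rightarrow> real \<Rightarrow> bool" where
  "critical_at g t0 \<longleftrightarrow> \<not> topologically_regular_at g t0"

definition local_max_at :: "(real \<Rightarrow> real) \<Rightarrow> real \<Rightarrow> bool" where
  "local_max_at g t0 \<longleftrightarrow> (\<forall>\<^sub>F t in nhds t0. g t \<le> g t0)"

definition local_min_at :: "(real \<Rightarrow> real) \<Rightarrow> real \<Rightarrow> bool" where
  "local_min_at g t0 \<longleftrightarrow> (\<forall>\<^sub>F t in nhds t0. g t0 \<le> g t)"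

end

theory Submission
  imports Defs
begin

text \<open>Since \<open>q > p\<close>, the second coordinate is \<open>t\<^sup>p\<close> times a power series vanishing at 0, so
  \<open>\<D>\<^sub>u(t) - \<D>\<^sub>u(0) = t\<^sup>p F(t)\<close> with \<open>F\<close> continuous at 0 and \<open>F(0) = -2 u\<^sub>1\<close>. As \<open>p\<close> is even, the
  sign of \<open>F(0)\<close> decides between maximum and minimum. A locally injective continuous function has no
  local extremum, whence the point is critical.\<close>

text \<open>A nonzero linear map of the reals is multiplication by \<open>l 1\<close>, with
  \<open>l 1\<close> nonzero. Composed with a homeomorphism it stays injective and continuous, hence
  strictly monotone on an interval around \<open>t0\<close>.\<close>

lemma topologically_regular_at_imp_not_local_extremum:
  assumes "topologically_regular_at g t0"
  shows "\<not> local_max_at g t0" "\<not> local_min_at g t0"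
proof -
  obtain U V and \<phi> \<psi> l :: "real \<Rightarrow> real" where U: "open U" "t0 \<in> U" and hom: "homeomorphism U V \<phi> \<psi>"
    and l: "linear l" "l \<noteq> (\<lambda>s. 0)" and g: "\<And>t. t \<in> U \<Longrightarrow> g t = l (\<phi> t)"
    using assms unfolding topologically_regular_at_def by blast
  have lin: "l s = s * l 1" for s
    using linear_scale[OF l(1), of s 1] by simp
  with l(2) have "l 1 \<noteq> 0"
    by (metis mult_zero_right)
  then have "inj l"
    using lin by (metis injI mult_cancel_right)
  moreover have "inj_on \<phi> U"
    using hom by (metis homeomorphism_apply1 inj_onI)
  ultimately have inj: "inj_on g U"
    by (metis (mono_tags, lifting) g injD inj_onD inj_onI)
  have cont: "continuous_on U g"
  proof -
    have "continuous_on U (\<lambda>t. \<phi> t * l 1)"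
      using hom by (intro continuous_intros) (auto simp: homeomorphism_def)
    then show ?thesis
      using g lin by (metis (no_types, lifting) continuous_on_cong)
  qed
  have both_sides: "\<exists>e1 e2. dist e1 t0 < d \<and> dist e2 t0 < d \<and> g e1 < g t0 \<and> g t0 < g e2"
    if "d > 0" for d
  proof -
    obtain r where r: "r > 0" "cball t0 r \<subseteq> U"
      using U open_contains_cball by blast
    \<comment> \<open>The bound \<open>r\<close> keeps the interval inside \<open>U\<close>; halving
      \<open>d\<close> puts its endpoints strictly within distance \<open>d\<close> of
      \<open>t0\<close>.\<close>
    define e where "e = min r (d / 2)"
    have "{t0 - e..t0 + e} \<subseteq> cball t0 r"
      by (auto simp: e_def cball_eq_atLeastAtMost)
    with r that have e: "e > 0" "e < d" "{t0 - e..t0 + e} \<subseteq> U"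
      by (auto simp: e_def)
    have "g (t0 - e) < g t0 \<and> g t0 < g (t0 + e) \<or> g (t0 + e) < g t0 \<and> g t0 < g (t0 - e)"
      using e by (intro continuous_inj_imp_mono continuous_on_subset[OF cont] inj_on_subset[OF inj]) auto
    moreover have "dist (t0 - e) t0 < d" "dist (t0 + e) t0 < d"
      using e by (auto simp: dist_real_def)
    ultimately show ?thesis
      by blast
  qed
  show "\<not> local_max_at g t0" "\<not> local_min_at g t0"
    unfolding local_max_at_def local_min_at_def eventually_nhds_metric
    using both_sides by (meson not_less)+
qed

text \<open>Expand the squared norm of \<open>(x - u) + a *\<^sub>R e1 + b *\<^sub>R e2\<close>;
  orthonormality removes the mixed term in \<open>a * b\<close>.\<close>

lemma sq_dist_branch_param:
  assumes "orthonormal_frame e1 e2"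
  shows "sq_dist u (branch_param x e1 e2 A B t) =
    sq_dist u x - 2 * eval_fps A t * ((u - x) \<bullet> e1) - 2 * eval_fps B t * ((u - x) \<bullet> e2)
      + (eval_fps A t)\<^sup>2 + (eval_fps B t)\<^sup>2"
proof -
  define a b d where "a = eval_fps A t" and "b = eval_fps B t" and "d = x - u"
  have e: "e1 \<bullet> e1 = 1" "e2 \<bullet> e2 = 1" "e1 \<bullet> e2 = 0" "e2 \<bullet> e1 = 0"
    using assms by (simp_all add: orthonormal_frame_def norm_eq_1 inner_commute[of e2 e1])
  have "sq_dist u (branch_param x e1 e2 A B t) = (norm (d + a *\<^sub>R e1 + b *\<^sub>R e2))\<^sup>2"
    by (simp add: sq_dist_def branch_param_def a_def b_def d_def algebra_simps)
  also have "\<dots> = (norm d)\<^sup>2 + 2 * a * (d \<bullet> e1) + 2 * b * (d \<bullet> e2) + a\<^sup>2 + b\<^sup>2"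
    unfolding power2_norm_eq_inner inner_add_left inner_add_right inner_scaleR_left inner_scaleR_right e
      inner_commute[of e1 d] inner_commute[of e2 d]
    by algebra
  finally show ?thesis
    by (simp add: sq_dist_def a_def b_def d_def algebra_simps)
qed

text \<open>The factor \<open>h\<close> is the sum of the series shifted down by \<open>p\<close>.
  Its constant term is the coefficient of \<open>B\<close> at \<open>p\<close> itself, so the
  vanishing there, and not only below \<open>p\<close>, gives \<open>h 0 = 0\<close>.\<close>

lemma eval_fps_factor_power:
  fixes B :: "real fps"
  assumes "fps_conv_radius B > 0" and "\<And>n. n \<le> p \<Longrightarrow> fps_nth B n = 0"
  obtains h where "isCont h 0" "h 0 = 0" "\<forall>\<^sub>F t in nhds 0. eval_fps B t = t ^ p * h t"
proof
  let ?S = "fps_shift p B"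
  have B: "B = fps_X ^ p * ?S"
    using assms(2) by (auto simp: fps_eq_iff fps_X_power_mult_nth)
  have rad: "fps_conv_radius ?S > 0"
    using assms(1) by simp
  show "isCont (eval_fps ?S) 0"
    using continuous_on_eval_fps[of ?S] rad
    by (auto simp: continuous_on_eq_continuous_at zero_ereal_def)
  show "eval_fps ?S 0 = 0"
    by (simp add: eval_fps_at_0 assms(2))
  \<comment> \<open>Evaluation is multiplicative only inside the discs of convergence, so the
    factorization is claimed only near 0.\<close>
  have "\<forall>\<^sub>F t :: real in nhds 0. t \<in> eball 0 (fps_conv_radius ?S)"
    using rad by (intro eventually_nhds_in_open) (auto simp: zero_ereal_def)
  then show "\<forall>\<^sub>F t in nhds 0. eval_fps B t = t ^ p * eval_fps ?S t"
  proof eventually_elim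
    case (elim t)
    then have "eval_fps (fps_X ^ p * ?S) t = t ^ p * eval_fps ?S t"
      by (subst eval_fps_mult) (auto simp: eval_fps_power)
    then show ?case
      using B by simp
  qed
qed

text \<open>By continuity \<open>F\<close> keeps the sign of \<open>F 0\<close> near 0, and
  \<open>t ^ p\<close> is nonnegative on both sides of 0 because \<open>p\<close> is even.\<close>

lemma local_extremum_at_0_of_even_power_mult:
  fixes g F :: "real \<Rightarrow> real"
  assumes "\<forall>\<^sub>F t in nhds 0. g t = g 0 + t ^ p * F t" and F: "isCont F 0" and "even p"
  shows "F 0 < 0 \<Longrightarrow> local_max_at g 0" "F 0 > 0 \<Longrightarrow> local_min_at g 0"
proof -
  have lim: "(F \<longlongrightarrow> F 0) (nhds 0)"
    using F by (simp add: isCont_def tendsto_at_iff_tendsto_nhds)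
  show "local_max_at g 0" if "F 0 < 0"
    unfolding local_max_at_def
    using assms(1) order_tendstoD(2)[OF lim that]
    by eventually_elim
      (use \<open>even p\<close> in \<open>auto intro!: mult_nonneg_nonpos zero_le_even_power\<close>)
  show "local_min_at g 0" if "F 0 > 0"
    unfolding local_min_at_def
    using assms(1) order_tendstoD(1)[OF lim that]
    by eventually_elim
      (use \<open>even p\<close> in \<open>auto intro!: mult_nonneg_nonneg zero_le_even_power\<close>)
qed

theorem proposition3:
  fixes X :: "(real^2) set" and x e1 e2 :: "real^2"
    and A B \<sigma> :: "real fps" and p q :: nat and c :: real
  assumes curve: "real_algebraic_curve X"
    and x_in: "x \<in> X"
    and sing: "geometric_singular_point X x"
    and branch: "local_branch X x e1 e2 A B"
    and form: "branch_normal_form A B p q c \<sigma>"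
    and p_ge: "p \<ge> 2"
    and p_even: "even p"
  shows "\<forall>u. u \<notin> normal_line x e1 \<longrightarrow>
           critical_at (\<lambda>t. sq_dist u (branch_param x e1 e2 A B t)) 0 \<and>
           ((u - x) \<bullet> e1 > 0 \<longrightarrow> local_max_at (\<lambda>t. sq_dist u (branch_param x e1 e2 A B t)) 0) \<and>
           ((u - x) \<bullet> e1 < 0 \<longrightarrow> local_min_at (\<lambda>t. sq_dist u (branch_param x e1 e2 A B t)) 0)"
proof (intro allI impI)
  fix u assume "u \<notin> normal_line x e1"
  then have u1: "(u - x) \<bullet> e1 \<noteq> 0"
    by (simp add: normal_line_def)
  let ?g = "\<lambda>t. sq_dist u (branch_param x e1 e2 A B t)"
  have frame: "orthonormal_frame e1 e2" and "fps_conv_radius B > 0"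
    using branch by (auto simp: local_branch_def)
  moreover have A: "eval_fps A t = t ^ p" for t
    using form by (simp add: branch_normal_form_def eval_fps_power)
  \<comment> \<open>Since \<open>p < q\<close>, both \<open>c * t ^ q\<close> and
    \<open>\<sigma>\<close> start beyond degree \<open>p\<close>.\<close>
  moreover have "fps_nth B n = 0" if "n \<le> p" for n
    using form that by (auto simp: branch_normal_form_def)
  ultimately obtain h where h: "isCont h 0" "h 0 = 0"
    and B: "\<forall>\<^sub>F t in nhds 0. eval_fps B t = t ^ p * h t"
    using eval_fps_factor_power by metis
  \<comment> \<open>Insert \<open>t ^ p\<close> and \<open>t ^ p * h t\<close> for the coordinates
    and divide by \<open>t ^ p\<close>; the two squares still carry a factor \<open>t ^ p\<close>,
    so they vanish at 0.\<close>
  define F where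
    "F t = - 2 * ((u - x) \<bullet> e1) - 2 * h t * ((u - x) \<bullet> e2) + t ^ p * (1 + (h t)\<^sup>2)" for t
  have F: "isCont F 0"
    unfolding F_def using h(1) by (intro continuous_intros)
  have F0: "F 0 = - 2 * ((u - x) \<bullet> e1)"
    using h(2) p_ge by (simp add: F_def)
  \<comment> \<open>A property holding eventually in \<open>nhds 0\<close> holds at 0 itself, so the
    second coordinate is 0 there as well.\<close>
  have "?g 0 = sq_dist u x"
    using eventually_nhds_x_imp_x[OF B] p_ge by (simp add: sq_dist_branch_param[OF frame] A power_0_left)
  then have "\<forall>\<^sub>F t in nhds 0. ?g t = ?g 0 + t ^ p * F t"
    using B by (auto elim!: eventually_mono
        simp: sq_dist_branch_param[OF frame] A F_def power2_eq_square algebra_simps)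
  note ext = local_extremum_at_0_of_even_power_mult[OF this F p_even]
  have max: "local_max_at ?g 0" if "(u - x) \<bullet> e1 > 0"
    using ext(1) F0 that by simp
  have min: "local_min_at ?g 0" if "(u - x) \<bullet> e1 < 0"
    using ext(2) F0 that by simp
  \<comment> \<open>Off the normal line one of the two signs occurs, so there is an extremum, which
    regularity excludes.\<close>
  have "critical_at ?g 0"
    unfolding critical_at_def
    using u1 max min topologically_regular_at_imp_not_local_extremum by (meson linorder_neqE)
  with max min show "critical_at ?g 0 \<and> ((u - x) \<bullet> e1 > 0 \<longrightarrow> local_max_at ?g 0) \<and>
      ((u - x) \<bullet> e1 < 0 \<longrightarrow> local_min_at ?g 0)"
    by blast
qed

end
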